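(* Let $K$ be a field of characteristic $0$ and let $p\ge 0$ be an integer. Let $\mathcal{X}(p,2p+1)$ denote the image of the linear map $L: K^{2p+1}\to \operatorname{Hom}(\bigwedge^p K^{2p+1},\bigwedge^{p+1}K^{2p+1})$, $v\mapsto L_v$, where $L_v(x)=v\wedge x$. Then $$\frac{\operatorname{ncrk}(\mathcal{X}(p,2p+1))}{\operatorname{rk}(\mathcal{X}(p,2p+1))}=\frac{2p+1}{p+1}.$$
   Context: After choosing bases, $\operatorname{Hom}(V,W)$ is identified with a space of matrices. For a linear subspace $\mathcal{X}\subseteq\operatorname{Mat}_{k,l}(K)$, $\operatorname{rk}(\mathcal{X})$ denotes the maximal rank among its members. For $d\ge 1$, the tensor blow-up is $\mathcal{X}^{\{d\}}=\mathcal{X}\otimes \operatorname{Mat}_{d,d}(K)=\{\sum_i X_i\otimes T_i \mid X_i\in\mathcal{X},\ T_i\in\operatorname{Mat}_{d,d}(K)\}\subseteq\operatorname{Mat}_{kd,ld}(K)$ (Kronecker product). The non-commutative rank is $\operatorname{ncrk}(\mathcal{X})=\max_{d\ge 1}\frac{\operatorname{rk}(\mathcal{X}^{\{d\}})}{d}=\lim_{d\to\infty}\frac{\operatorname{rk}(\mathcal{X}^{\{d\}})}{d}$ (both exist and agree). *)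

theory Defs
  imports Complex_Main "Jordan_Normal_Form.DL_Rank"
begin

section \<open>Matrix spaces, tensor blow-ups and non-commutative rank\<close>

definition mrank :: "'a::field mat \<Rightarrow> nat" where
  "mrank A = vec_space.rank (dim_row A) A"

definition rk :: "'a::field mat set \<Rightarrow> nat" where
  "rk X = Max (mrank ` X)"

definition kron :: "'a::semiring_0 mat \<Rightarrow> 'a mat \<Rightarrow> 'a mat" where
  "kron A B = mat (dim_row A * dim_row B) (dim_col A * dim_col B)
     (\<lambda>(i, j). A $$ (i div dim_row B, j div dim_col B) * B $$ (i mod dim_row B, j mod dim_col B))"

text \<open>\<open>blow_up k l d X\<close> is the set of all finite sums of Kronecker products \<open>kron A T\<close> with
  \<open>A\<close> in the space \<open>X\<close> of \<open>k\<close> by \<open>l\<close> matrices and \<open>T\<close> an arbitrary \<open>d\<close> by \<open>d\<close> matrix.\<close>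

definition blow_up :: "nat \<Rightarrow> nat \<Rightarrow> nat \<Rightarrow> 'a::semiring_0 mat set \<Rightarrow> 'a mat set" where
  "blow_up k l d X =
     {foldr (+) (map (\<lambda>(A, T). kron A T) ps) (0\<^sub>m (k * d) (l * d)) | ps.
        set ps \<subseteq> X \<times> carrier_mat d d}"

text \<open>The non-commutative rank is an attained maximum (not merely a supremum), hence the use of
  \<open>Greatest\<close>.\<close>

definition ncrk :: "nat \<Rightarrow> nat \<Rightarrow> 'a::field mat set \<Rightarrow> real" where
  "ncrk k l X = (GREATEST r. \<exists>d\<ge>1. r = real (rk (blow_up k l d X)) / real d)"

lemma mrank_le_dim_col: "mrank A \<le> dim_col A"
  unfolding mrank_def by (rule vec_space.rank_le_nc[of _ "dim_row A"]) auto

lemma rk_attained_and_bound: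
  assumes "X \<subseteq> carrier_mat k l" "X \<noteq> {}"
  shows "rk X \<in> mrank ` X" "A \<in> X \<Longrightarrow> mrank A \<le> rk X" "rk X \<le> l"
proof -
  have b: "mrank A \<le> l" if "A \<in> X" for A
    using mrank_le_dim_col[of A] assms(1) that by auto
  have fin: "finite (mrank ` X)"
    by (rule finite_subset[of _ "{..l}"]) (use b in auto)
  show "rk X \<in> mrank ` X" "A \<in> X \<Longrightarrow> mrank A \<le> rk X"
    unfolding rk_def using fin assms(2) by (auto intro: Max_in)
  then show "rk X \<le> l" using b by auto
qed

lemma kron_carrier:
  "A \<in> carrier_mat k l \<Longrightarrow> T \<in> carrier_mat d e \<Longrightarrow> kron A T \<in> carrier_mat (k * d) (l * e)"
  unfolding kron_def by auto

lemma blow_up_carrier: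
  assumes "X \<subseteq> carrier_mat k l"
  shows "blow_up k l d X \<subseteq> carrier_mat (k * d) (l * d)"
proof -
  have "foldr (+) (map (\<lambda>(A, T). kron A T) ps) (0\<^sub>m (k * d) (l * d)) \<in> carrier_mat (k * d) (l * d)"
    if "set ps \<subseteq> X \<times> carrier_mat d d" for ps
    using that
  proof (induction ps)
    case (Cons q ps)
    then show ?case using assms kron_carrier[of "fst q" k l "snd q" d d]
      by (cases q) auto
  qed simp
  then show ?thesis unfolding blow_up_def by auto
qed

section \<open>The exterior algebra\<close>

text \<open>An element of the exterior algebra of \<open>K\<^sup>n\<close> is encoded by its coordinates with respect to
  the basis \<open>e\<^sub>S = e\<^sub>i\<^sub>1 \<and> \<dots> \<and> e\<^sub>i\<^sub>p\<close> for \<open>S = {i\<^sub>1 < \<dots> < i\<^sub>p} \<subseteq> {0..<n}\<close>,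
  i.e. as a function from sets of indices to \<open>K\<close> supported on subsets of \<open>{0..<n}\<close>.\<close>

type_synonym 'a ext = "nat set \<Rightarrow> 'a"

definition ext_power :: "nat \<Rightarrow> nat \<Rightarrow> 'a::zero ext set" where
  "ext_power n p = {x. \<forall>S. x S \<noteq> 0 \<longrightarrow> S \<subseteq> {0..<n} \<and> card S = p}"

definition ext_unit :: "nat set \<Rightarrow> 'a::zero_neq_one ext" where
  "ext_unit S = (\<lambda>T. if T = S then 1 else 0)"

text \<open>For disjoint finite \<open>A\<close> and \<open>B\<close> one has \<open>e\<^sub>A \<and> e\<^sub>B = shuffle_sign A B e\<^bsub>A \<union> B\<^esub>\<close>: the exponent
  counts the transpositions needed to sort the concatenation of \<open>A\<close> and \<open>B\<close>.\<close>

definition shuffle_sign :: "nat set \<Rightarrow> nat set \<Rightarrow> 'a::comm_ring_1" where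
  "shuffle_sign A B = (- 1) ^ card {(a, b) \<in> A \<times> B. b < a}"

definition wedge :: "'a::comm_ring_1 ext \<Rightarrow> 'a ext \<Rightarrow> 'a ext" where
  "wedge x y = (\<lambda>S. \<Sum>A\<in>Pow S. shuffle_sign A (S - A) * x A * y (S - A))"

text \<open>The inclusion of \<open>K\<^sup>n\<close> as the degree one part.\<close>

definition ext_of_vec :: "'a::comm_ring_1 vec \<Rightarrow> 'a ext" where
  "ext_of_vec v = (\<lambda>S. \<Sum>i<dim_vec v. v $ i * ext_unit {i} S)"

definition left_wedge :: "'a::comm_ring_1 vec \<Rightarrow> 'a ext \<Rightarrow> 'a ext" where
  "left_wedge v x = wedge (ext_of_vec v) x"

text \<open>The index sets of the standard basis of the \<open>p\<close>-th exterior power, in lexicographic order.\<close>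

definition ext_basis :: "nat \<Rightarrow> nat \<Rightarrow> nat set list" where
  "ext_basis n p = filter (\<lambda>S. card S = p) (map set (subseqs [0..<n]))"

definition ext_matrix :: "nat \<Rightarrow> nat \<Rightarrow> nat \<Rightarrow> ('a::comm_ring_1 ext \<Rightarrow> 'a ext) \<Rightarrow> 'a mat" where
  "ext_matrix n p q f = mat (length (ext_basis n q)) (length (ext_basis n p))
     (\<lambda>(i, j). f (ext_unit (ext_basis n p ! j)) (ext_basis n q ! i))"

text \<open>The image of \<open>v \<mapsto> L\<^sub>v\<close>, as a space of matrices
  with \<open>n choose (p + 1)\<close> rows and \<open>n choose p\<close> columns.\<close>

definition wedge_space :: "nat \<Rightarrow> nat \<Rightarrow> 'a::comm_ring_1 mat set" where
  "wedge_space p n = (\<lambda>v. ext_matrix n p (p + 1) (left_wedge v)) ` carrier_vec n"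

subsection \<open>The coordinate model satisfies the laws of the exterior algebra\<close>

lemma set_ext_basis: "set (ext_basis n p) = {S. S \<subseteq> {0..<n} \<and> card S = p}"
proof -
  have "set ` set (subseqs [0..<n]) = Pow {0..<n}" by (simp add: subseqs_powset)
  then show ?thesis unfolding ext_basis_def by auto
qed

lemma distinct_ext_basis: "distinct (ext_basis n p)"
  unfolding ext_basis_def by (simp add: distinct_set_subseqs)

lemma length_ext_basis: "length (ext_basis n p) = n choose p"
  using distinct_card[OF distinct_ext_basis[of n p]] n_subsets[of "{0..<n}" p]
  by (simp add: set_ext_basis)

lemma wedge_distrib:
  "wedge (\<lambda>S. x S + x' S) y = (\<lambda>S. wedge x y S + wedge x' y S)"
  "wedge x (\<lambda>S. y S + y' S) = (\<lambda>S. wedge x y S + wedge x y' S)"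
  "wedge (\<lambda>S. c * x S) y = (\<lambda>S. c * wedge x y S)"
  "wedge x (\<lambda>S. c * y S) = (\<lambda>S. c * wedge x y S)"
  by (simp_all add: fun_eq_iff wedge_def ring_distribs sum.distrib sum_distrib_left mult_ac)

lemma wedge_sum_right:
  "finite I \<Longrightarrow> wedge x (\<lambda>S. \<Sum>i\<in>I. y i S) = (\<lambda>S. \<Sum>i\<in>I. wedge x (y i) S)"
proof (induction I rule: finite_induct)
  case empty
  then show ?case by (simp add: wedge_def)
next
  case (insert i I)
  then show ?case using wedge_distrib(2)[of x "y i" "\<lambda>S. \<Sum>i\<in>I. y i S"] by simp
qed

lemma wedge_sum_left:
  "finite I \<Longrightarrow> wedge (\<lambda>S. \<Sum>i\<in>I. x i S) y = (\<lambda>S. \<Sum>i\<in>I. wedge (x i) y S)"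
proof (induction I rule: finite_induct)
  case empty
  then show ?case by (simp add: wedge_def)
next
  case (insert i I)
  then show ?case using wedge_distrib(1)[of "x i" "\<lambda>S. \<Sum>i\<in>I. x i S" y] by simp
qed

lemma shuffle_sign_union_left:
  assumes "finite A" "finite B" "finite C" "A \<inter> B = {}"
  shows "shuffle_sign (A \<union> B) C = shuffle_sign A C * shuffle_sign B C"
proof -
  have *: "{(a, b) \<in> (A \<union> B) \<times> C. b < a} = {(a, b) \<in> A \<times> C. b < a} \<union> {(a, b) \<in> B \<times> C. b < a}"
    by auto
  have fin: "finite {(a, b) \<in> D \<times> C. b < a}" if "finite D" for D
    by (rule finite_subset[of _ "D \<times> C"]) (use that assms in auto)
  show ?thesis unfolding shuffle_sign_def * power_add[symmetric]
    by (subst card_Un_disjoint) (use fin assms in auto)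
qed

lemma shuffle_sign_union_right:
  assumes "finite A" "finite B" "finite C" "B \<inter> C = {}"
  shows "shuffle_sign A (B \<union> C) = shuffle_sign A B * shuffle_sign A C"
proof -
  have *: "{(a, b) \<in> A \<times> (B \<union> C). b < a} = {(a, b) \<in> A \<times> B. b < a} \<union> {(a, b) \<in> A \<times> C. b < a}"
    by auto
  have fin: "finite {(a, b) \<in> A \<times> D. b < a}" if "finite D" for D
    by (rule finite_subset[of _ "A \<times> D"]) (use that assms in auto)
  show ?thesis unfolding shuffle_sign_def * power_add[symmetric]
    by (subst card_Un_disjoint) (use fin assms in auto)
qed

lemma wedge_assoc: "wedge (wedge x y) z = wedge x (wedge y z)"
proof (rule ext)
  fix S :: "nat set"
  show "wedge (wedge x y) z S = wedge x (wedge y z) S"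
  proof (cases "finite S")
    case False
    then show ?thesis by (simp add: wedge_def)
  next
    case True
    have fs: "finite C" if "C \<subseteq> S" for C using True that finite_subset by auto
    have "wedge (wedge x y) z S =
      (\<Sum>C\<in>Pow S. \<Sum>A\<in>Pow C. shuffle_sign C (S - C) * shuffle_sign A (C - A)
          * x A * y (C - A) * z (S - C))"
      unfolding wedge_def by (simp add: sum_distrib_left sum_distrib_right mult.assoc)
    also have "\<dots> = (\<Sum>(C, A)\<in>(SIGMA C:Pow S. Pow C). shuffle_sign C (S - C)
          * shuffle_sign A (C - A) * x A * y (C - A) * z (S - C))"
      using True fs by (subst sum.Sigma) auto
    also have "\<dots> = (\<Sum>(A, B)\<in>(SIGMA A:Pow S. Pow (S - A)). shuffle_sign A (S - A)
          * shuffle_sign B (S - A - B) * x A * y B * z (S - A - B))"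
    proof (rule sum.reindex_bij_witness[where j = "\<lambda>(C, A). (A, C - A)" and i = "\<lambda>(A, B). (A \<union> B, A)"],
        goal_cases)
      case (5 q)
      obtain C A where q: "q = (C, A)" by (cases q)
      with 5 have CA: "C \<subseteq> S" "A \<subseteq> C" by auto
      have fin: "finite A" "finite (C - A)" "finite (S - C)" using CA fs by auto
      have C: "C = A \<union> (C - A)" and SA: "S - A = (C - A) \<union> (S - C)" using CA by auto
      have 1: "shuffle_sign C (S - C) = (shuffle_sign A (S - C) * shuffle_sign (C - A) (S - C) :: 'a)"
        using shuffle_sign_union_left[of A "C - A" "S - C"] fin C by auto
      have 2: "shuffle_sign A (S - A) = (shuffle_sign A (C - A) * shuffle_sign A (S - C) :: 'a)"
        using shuffle_sign_union_right[of A "C - A" "S - C"] fin SA by auto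
      have 3: "S - A - (C - A) = S - C" using CA by auto
      show ?case unfolding q by (simp add: 1 2 3 mult_ac)
    qed auto
    also have "\<dots> = (\<Sum>A\<in>Pow S. \<Sum>B\<in>Pow (S - A). shuffle_sign A (S - A)
          * shuffle_sign B (S - A - B) * x A * y B * z (S - A - B))"
      using True fs by (subst sum.Sigma) auto
    also have "\<dots> = wedge x (wedge y z) S"
      unfolding wedge_def by (simp add: sum_distrib_left sum_distrib_right mult_ac)
    finally show ?thesis .
  qed
qed

lemma wedge_ext_unit:
  assumes "finite A" "finite B"
  shows "wedge (ext_unit A) (ext_unit B) =
    (\<lambda>S. if A \<inter> B = {} then shuffle_sign A B * ext_unit (A \<union> B) S else 0)"
proof (rule ext)
  fix S
  have "wedge (ext_unit A) (ext_unit B) S =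
      (\<Sum>C\<in>Pow S. if C = A then (if S - A = B then shuffle_sign A B else 0) else 0)"
    unfolding wedge_def ext_unit_def by (rule sum.cong) auto
  also have "\<dots> = (if A \<subseteq> S \<and> S - A = B then shuffle_sign A B else 0)"
  proof (cases "finite S")
    case True
    then show ?thesis by (subst sum.delta) auto
  next
    case False
    then have "\<not> (A \<subseteq> S \<and> S - A = B)" using assms by (metis Diff_partition finite_UnI)
    then show ?thesis using False by auto
  qed
  also have "\<dots> = (if A \<inter> B = {} then shuffle_sign A B * ext_unit (A \<union> B) S else 0)"
    unfolding ext_unit_def by auto
  finally show "wedge (ext_unit A) (ext_unit B) S = \<dots>" .
qed

text \<open>The basis element with index set \<open>{i\<^sub>1 < \<dots> < i\<^sub>p}\<close> is \<open>e\<^sub>i\<^sub>1 \<and> \<dots> \<and> e\<^sub>i\<^sub>p\<close>, and \<open>ext_unit {}\<close> is the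
  unit of the algebra.\<close>

lemma ext_unit_insert_least:
  fixes i :: nat and S :: "nat set"
  assumes "finite S" "\<And>j. j \<in> S \<Longrightarrow> i < j"
  shows "(ext_unit (insert i S) :: 'a::comm_ring_1 ext) = wedge (ext_unit {i}) (ext_unit S)"
proof -
  have "{(a, b) \<in> {i} \<times> S. b < a} = {}" using assms(2) by fastforce
  then have "shuffle_sign {i} S = (1 :: 'a)" unfolding shuffle_sign_def by (simp only: card.empty power_0)
  moreover have "i \<notin> S" using assms(2) by blast
  ultimately show ?thesis using assms(1) by (auto simp: wedge_ext_unit)
qed

lemma shuffle_sign_empty: "shuffle_sign {} S = 1" "shuffle_sign S {} = 1"
  by (simp_all add: shuffle_sign_def)

lemma wedge_one:
  assumes "\<And>S. infinite S \<Longrightarrow> x S = 0"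
  shows "wedge (ext_unit {}) x = x" "wedge x (ext_unit {}) = x"
proof -
  have "wedge (ext_unit {}) x S = x S" for S
  proof -
    have "wedge (ext_unit {}) x S = (\<Sum>A\<in>Pow S. if A = {} then x S else 0)"
      unfolding wedge_def ext_unit_def by (rule sum.cong) (auto simp: shuffle_sign_empty)
    then show ?thesis using assms[of S] by (cases "finite S") auto
  qed
  moreover have "wedge x (ext_unit {}) S = x S" for S
  proof -
    have "wedge x (ext_unit {}) S = (\<Sum>A\<in>Pow S. if A = S then x S else 0)"
      unfolding wedge_def ext_unit_def by (rule sum.cong) (auto simp: shuffle_sign_empty)
    then show ?thesis using assms[of S] by (cases "finite S") auto
  qed
  ultimately show "wedge (ext_unit {}) x = x" "wedge x (ext_unit {}) = x" by auto
qed

lemma wedge_ext_unit_singleton_swap: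
  "wedge (ext_unit {i}) (ext_unit {j}) S = - wedge (ext_unit {j}) (ext_unit {i}) S"
proof -
  have "{(a, b) \<in> {i} \<times> {j}. b < a} = (if j < i then {(i, j)} else {})" for i j :: nat by auto
  then have *: "shuffle_sign {i} {j} = (if j < i then - 1 else 1)" for i j
    by (simp add: shuffle_sign_def)
  show ?thesis by (auto simp: wedge_ext_unit * insert_commute)
qed

lemma wedge_square_zero: "wedge (ext_of_vec v) (ext_of_vec v) = (\<lambda>S. 0)"
proof (rule ext)
  fix S
  let ?w = "\<lambda>i j. wedge (ext_unit {i}) (ext_unit {j}) S"
  let ?t = "\<lambda>i j. v $ i * v $ j * ?w i j"
  let ?N = "{..<dim_vec v}"
  have "wedge (ext_of_vec v) (ext_of_vec v) S = (\<Sum>i\<in>?N. \<Sum>j\<in>?N. ?t i j)"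
    unfolding ext_of_vec_def
    by (simp add: wedge_sum_left wedge_sum_right wedge_distrib sum_distrib_left mult.assoc
        mult.left_commute)
  also have "\<dots> = (\<Sum>i\<in>?N. \<Sum>j\<in>?N. (if i < j then ?t i j else 0) + (if j < i then ?t i j else 0))"
  proof (intro sum.cong refl)
    fix i j :: nat
    show "?t i j = (if i < j then ?t i j else 0) + (if j < i then ?t i j else 0)"
      by (cases i j rule: linorder_cases) (auto simp: wedge_ext_unit)
  qed
  also have "\<dots> = (\<Sum>i\<in>?N. \<Sum>j\<in>?N. if i < j then ?t i j else 0)
      + (\<Sum>i\<in>?N. \<Sum>j\<in>?N. if j < i then ?t i j else 0)"
    by (simp add: sum.distrib)
  also have "(\<Sum>i\<in>?N. \<Sum>j\<in>?N. if j < i then ?t i j else 0) =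
      (\<Sum>j\<in>?N. \<Sum>i\<in>?N. if j < i then ?t i j else 0)"
    by (rule sum.swap)
  also have "\<dots> = (\<Sum>j\<in>?N. \<Sum>i\<in>?N. - (if j < i then ?t j i else 0))"
  proof (intro sum.cong refl)
    fix j i :: nat
    show "(if j < i then ?t i j else 0) = - (if j < i then ?t j i else 0)"
      by (subst wedge_ext_unit_singleton_swap[of i j S]) (simp add: mult.commute[of "v $ i"])
  qed
  also have "\<dots> = - (\<Sum>j\<in>?N. \<Sum>i\<in>?N. (if j < i then ?t j i else 0))"
    by (simp add: sum_negf)
  finally show "wedge (ext_of_vec v) (ext_of_vec v) S = 0" by simp
qed

lemma wedge_ext_power:
  assumes "x \<in> ext_power n p" "y \<in> ext_power n q"
  shows "wedge x y \<in> ext_power n (p + q)"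
  unfolding ext_power_def
proof (intro CollectI allI impI)
  fix S assume "wedge x y S \<noteq> 0"
  then obtain A where A: "A \<subseteq> S" "x A \<noteq> 0" "y (S - A) \<noteq> 0"
    unfolding wedge_def by (metis (no_types, lifting) PowD mult_zero_left mult_zero_right sum.neutral)
  then have "A \<subseteq> {0..<n}" "card A = p" "S - A \<subseteq> {0..<n}" "card (S - A) = q"
    using assms unfolding ext_power_def by auto
  then show "S \<subseteq> {0..<n} \<and> card S = p + q"
    using A(1) card_Un_disjoint[of A "S - A"]
    by (metis Diff_disjoint Diff_partition Un_least finite_atLeastLessThan finite_subset)
qed

lemma ext_of_vec_ext_power:
  "v \<in> carrier_vec n \<Longrightarrow> ext_of_vec v \<in> ext_power n 1"
  unfolding ext_power_def
proof (intro CollectI allI impI)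
  fix S assume v: "v \<in> carrier_vec n" and "ext_of_vec v S \<noteq> 0"
  then obtain i where "i < dim_vec v" "v $ i * ext_unit {i} S \<noteq> 0"
    unfolding ext_of_vec_def by (meson lessThan_iff sum.not_neutral_contains_not_neutral)
  then have "i < n" "S = {i}" using v by (auto simp: ext_unit_def split: if_splits)
  then show "S \<subseteq> {0..<n} \<and> card S = 1" by simp
qed

lemma ext_power_expand:
  fixes x :: "'a::comm_ring_1 ext"
  assumes "x \<in> ext_power n p"
  shows "x = (\<lambda>S. \<Sum>j<length (ext_basis n p). x (ext_basis n p ! j) * ext_unit (ext_basis n p ! j) S)"
proof (rule ext)
  fix S
  let ?b = "ext_basis n p"
  have bij: "bij_betw (\<lambda>j. ?b ! j) {..<length ?b} (set ?b)"
    by (rule bij_betw_nth) (simp_all add: distinct_ext_basis)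
  have "(\<Sum>j<length ?b. x (?b ! j) * ext_unit (?b ! j) S) = (\<Sum>T\<in>set ?b. x T * ext_unit T S)"
    by (rule sum.reindex_bij_betw[OF bij])
  also have "\<dots> = (\<Sum>T\<in>set ?b. if T = S then x S else 0)"
    by (rule sum.cong) (auto simp: ext_unit_def)
  also have "\<dots> = x S" using assms by (auto simp: set_ext_basis ext_power_def)
  finally show "x S = (\<Sum>j<length ?b. x (?b ! j) * ext_unit (?b ! j) S)" by simp
qed

text \<open>\<open>ext_matrix\<close> represents \<open>left_wedge v\<close> in coordinates.\<close>

lemma ext_matrix_left_wedge:
  assumes "x \<in> ext_power n p"
  shows "ext_matrix n p q (left_wedge v) *\<^sub>v vec (n choose p) (\<lambda>j. x (ext_basis n p ! j)) =
    vec (n choose q) (\<lambda>i. left_wedge v x (ext_basis n q ! i))"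
proof (rule eq_vecI)
  fix i assume "i < dim_vec (vec (n choose q) (\<lambda>i. left_wedge v x (ext_basis n q ! i)))"
  then have i: "i < n choose q" by simp
  let ?b = "ext_basis n p"
  have "left_wedge v x = (\<lambda>S. \<Sum>j<length ?b. x (?b ! j) * left_wedge v (ext_unit (?b ! j)) S)"
    unfolding left_wedge_def
    by (subst ext_power_expand[OF assms]) (simp add: wedge_sum_right wedge_distrib)
  then show "(ext_matrix n p q (left_wedge v) *\<^sub>v vec (n choose p) (\<lambda>j. x (?b ! j))) $ i =
      vec (n choose q) (\<lambda>i. left_wedge v x (ext_basis n q ! i)) $ i"
    using i by (simp add: ext_matrix_def length_ext_basis scalar_prod_def mult.commute
        atLeast0LessThan)
qed (simp add: ext_matrix_def length_ext_basis)

lemma wedge_space_carrier: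
  "wedge_space p n \<subseteq> carrier_mat (n choose (p + 1)) (n choose p)"
  unfolding wedge_space_def ext_matrix_def by (auto simp: length_ext_basis)

lemma wedge_space_nonempty: "wedge_space p n \<noteq> {}"
  unfolding wedge_space_def using zero_carrier_vec by blast

end

theory Submission
  imports Defs
begin

text \<open>
  Put \<open>n = 2p + 1\<close> and \<open>d = n choose p = n choose (p + 1)\<close>, so that the operators \<open>L\<^sub>v\<close> are \<open>d\<close> by
  \<open>d\<close> matrices. The two ranks are \<open>(2p) choose p\<close> and \<open>d\<close>, whose quotient is \<open>(2p + 1)/(p + 1)\<close>.

  The rank of a single \<open>L\<^sub>v\<close>. If the coordinate \<open>v\<^sub>k\<close> is nonzero, then \<open>v \<and> (v \<and> e\<^sub>T) = 0\<close> for
  \<open>k \<notin> T\<close> expresses the column of \<open>L\<^sub>v\<close> with index \<open>T \<union> {k}\<close> through columns whose index sets avoid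
  \<open>k\<close>. There are only \<open>(n - 1) choose p\<close> of those. For \<open>v = e\<^sub>0\<close> these columns are distinct unit
  vectors, hence the bound is attained (\<open>rk_wedge_space\<close>).

  The non-commutative rank. The normalised rank of a blow-up cannot exceed \<open>d\<close>, so it suffices to
  find one invertible matrix in one blow-up (\<open>ncrk_eq_of_full_blow_up\<close>). It is
  \<open>\<Sum>\<^sub>i L\<^sub>i \<otimes> L\<^sub>i\<^sup>T\<close>, with \<open>L\<^sub>i\<close> the operator of the basis vector \<open>e\<^sub>i\<close>. As \<open>L\<^sub>i\<^sup>T\<close> is the contraction
  by \<open>e\<^sub>i\<close>, this matrix moves a basis vector from the second factor to the first:
  it is the polarization map \<open>\<Lambda>\<^sup>p \<otimes> \<Lambda>\<^sup>p\<^sup>+\<^sup>1 \<rightarrow> \<Lambda>\<^sup>p\<^sup>+\<^sup>1 \<otimes> \<Lambda>\<^sup>p\<close>. Conceptually it is the raising operator of the Lie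
  algebra \<open>sl\<^sub>2\<close> acting on \<open>\<Lambda> \<otimes> \<Lambda>\<close>, taken from weight \<open>-1\<close> to weight \<open>1\<close>, and such an operator is
  bijective in characteristic \<open>0\<close>.

  The proof of bijectivity below is elementary. On \<open>e\<^sub>S \<otimes> e\<^sub>T\<close> the map preserves \<open>S \<inter> T\<close> and the
  symmetric difference \<open>D\<close> of \<open>S\<close> and \<open>T\<close>, and the sign with which \<open>i\<close> is moved depends on \<open>i\<close> and \<open>D\<close>
  only. Rescaling the basis removes the signs and leaves, on each block, the inclusion matrix between
  the \<open>m\<close>-subsets and the \<open>(m + 1)\<close>-subsets of the set \<open>D\<close> with \<open>2m + 1\<close> elements. This matrix
  is injective by a counting argument (\<open>boolean_lattice_up_injective\<close>).
\<close>

section \<open>Inclusion of subsets of adjacent sizes\<close>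

text \<open>
  Double counting: \<open>g B\<close> occurs on the left once for every \<open>i\<close> outside \<open>B\<close> whose addition to \<open>B\<close>
  gives one of the sets \<open>A\<close> in the sum.
\<close>

lemma sum_layer_weighted:
  fixes g :: "'b set \<Rightarrow> 'a::comm_ring_1"
  assumes D: "finite D"
  shows "(\<Sum>A | A \<subseteq> D \<and> card A = Suc m \<and> Q A. \<Sum>i\<in>A. g (A - {i})) =
    (\<Sum>B | B \<subseteq> D \<and> card B = m. of_nat (card {i \<in> D - B. Q (insert i B)}) * g B)"
proof -
  let ?U = "{A. A \<subseteq> D \<and> card A = Suc m \<and> Q A}" and ?L = "{B. B \<subseteq> D \<and> card B = m}"
  have fin: "finite X" if "X \<subseteq> D" for X
    using D that finite_subset by blast
  have "(\<Sum>A\<in>?U. \<Sum>i\<in>A. g (A - {i})) = (\<Sum>(A, i)\<in>(SIGMA A:?U. A). g (A - {i}))"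
    by (rule sum.Sigma) (use D fin in auto)
  also have "\<dots> = (\<Sum>(B, i)\<in>(SIGMA B:?L. {i \<in> D - B. Q (insert i B)}). g B)"
    by (rule sum.reindex_bij_witness[where j = "\<lambda>(A, i). (A - {i}, i)"
          and i = "\<lambda>(B, i). (insert i B, i)"])
      (use fin in \<open>auto simp: card_insert_disjoint insert_absorb\<close>)
  also have "\<dots> = (\<Sum>B\<in>?L. \<Sum>i | i \<in> D - B \<and> Q (insert i B). g B)"
    by (rule sum.Sigma[symmetric]) (use D fin in auto)
  finally show ?thesis by simp
qed

text \<open>
  Group the \<open>m\<close>-subsets \<open>B\<close> by \<open>j = |B \<inter> B0|\<close>, and let \<open>s\<^sub>j\<close> be the sum of \<open>g\<close> over the group with
  number \<open>j\<close>. Add up the given equations over all \<open>A\<close> with \<open>|A \<inter> B0| = j\<close>. A set \<open>B\<close> of group \<open>j\<close> is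
  extended to such an \<open>A\<close> by each of the \<open>|D| - 2m + j\<close> elements outside \<open>B \<union> B0\<close>, and a set of group
  \<open>j - 1\<close> by each of the \<open>m - j + 1\<close> elements of \<open>B0 - B\<close>. Hence
  \<open>(|D| - 2m + j) s\<^sub>j + (m - j + 1) s\<^sub>j\<^sub>-\<^sub>1 = 0\<close>, where the first coefficient is a positive integer and
  so is invertible in characteristic \<open>0\<close>. Induction on \<open>j\<close> gives \<open>s\<^sub>j = 0\<close> for all \<open>j \<le> m\<close>, and the
  group with number \<open>m\<close> consists of \<open>B0\<close> alone.
\<close>

lemma boolean_lattice_up_injective:
  fixes g :: "'b set \<Rightarrow> 'a::field_char_0"
  assumes D: "finite D" and m: "2 * m < card D"
    and up: "\<And>A. A \<subseteq> D \<Longrightarrow> card A = Suc m \<Longrightarrow> (\<Sum>i\<in>A. g (A - {i})) = 0"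
    and B0: "B0 \<subseteq> D" "card B0 = m"
  shows "g B0 = 0"
proof -
  define s where "s j = (\<Sum>B | B \<subseteq> D \<and> card B = m \<and> card (B \<inter> B0) = j. g B)" for j
  have fin: "finite X" if "X \<subseteq> D" for X
    using D that finite_subset by blast
  have s0: "s j = 0" if "j \<le> m" for j
    using that
  proof (induction j rule: less_induct)
    case (less j)
    let ?N = "\<lambda>B. card {i \<in> D - B. card (insert i B \<inter> B0) = j}"
    have N_same: "?N B = card D + j - 2 * m"
      if B: "B \<subseteq> D" "card B = m" "card (B \<inter> B0) = j" for B
    proof -
      have "{i \<in> D - B. card (insert i B \<inter> B0) = j} = D - (B \<union> B0)"
        using B fin[OF B(1)] by (auto simp: Int_insert_left)
      moreover have "card (B \<union> B0) + j = 2 * m"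
        using card_Un_Int[of B B0] B B0 fin by auto
      moreover have "card (D - (B \<union> B0)) = card D - card (B \<union> B0)"
        using B B0 fin by (intro card_Diff_subset) auto
      ultimately show ?thesis
        using less.prems by simp
    qed
    have N_below: "?N B = Suc m - j"
      if B: "B \<subseteq> D" "card B = m" "Suc (card (B \<inter> B0)) = j" for B
    proof -
      have "{i \<in> D - B. card (insert i B \<inter> B0) = j} = B0 - B \<inter> B0"
        using B B0 fin[OF B(1)] by (auto simp: Int_insert_left)
      moreover have "card (B0 - B \<inter> B0) = m - card (B \<inter> B0)"
        using B0 fin by (subst card_Diff_subset) auto
      ultimately show ?thesis
        using B(3) by simp
    qed
    have N_other: "?N B = 0"
      if B: "B \<subseteq> D" "card (B \<inter> B0) \<noteq> j" "Suc (card (B \<inter> B0)) \<noteq> j" for B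
    proof -
      have "{i \<in> D - B. card (insert i B \<inter> B0) = j} = {}"
        using B fin[OF B(1)] by (auto simp: Int_insert_left)
      then show ?thesis by (simp only: card.empty)
    qed
    have "(\<Sum>B | B \<subseteq> D \<and> card B = m. of_nat (?N B) * g B) = 0"
      using up by (subst sum_layer_weighted[OF D, symmetric]) (simp add: sum.neutral)
    moreover have "(\<Sum>B | B \<subseteq> D \<and> card B = m. of_nat (?N B) * g B) =
      (\<Sum>B | B \<subseteq> D \<and> card B = m.
          (if card (B \<inter> B0) = j then of_nat (card D + j - 2 * m) * g B else 0)
        + (if Suc (card (B \<inter> B0)) = j then of_nat (Suc m - j) * g B else 0))"
      by (rule sum.cong) (use N_same N_below N_other in auto)
    moreover have "\<dots> = of_nat (card D + j - 2 * m) * s j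
        + of_nat (Suc m - j) * (if j = 0 then 0 else s (j - 1))"
      unfolding sum.distrib using D
      by (cases j) (simp_all add: s_def sum.If_cases sum_distrib_left Int_def conj_assoc flip: sum.inter_filter)
    moreover have "(if j = 0 then 0 else s (j - 1)) = 0"
      using less by auto
    moreover have "of_nat (card D + j - 2 * m) \<noteq> (0 :: 'a)"
      using m by (simp only: of_nat_eq_0_iff)
    ultimately show ?case by simp
  qed
  have "{B. B \<subseteq> D \<and> card B = m \<and> card (B \<inter> B0) = m} = {B0}"
  proof -
    have "B = B0" if "B \<subseteq> D" "card B = m" "card (B \<inter> B0) = m" for B
      using card_subset_eq[of B "B \<inter> B0"] card_subset_eq[of B0 "B \<inter> B0"] that B0 fin by auto
    then show ?thesis using B0 by auto
  qed
  then show ?thesis using s0[of m] by (simp add: s_def)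
qed

section \<open>Polarization between adjacent exterior powers\<close>

lemma shuffle_sign_square: "shuffle_sign A B * shuffle_sign A B = (1 :: 'a::comm_ring_1)"
  by (simp add: shuffle_sign_def flip: power_add mult_2)

text \<open>
  Here \<open>u\<close> holds the coordinates of an element of \<open>\<Lambda>\<^sup>p \<otimes> \<Lambda>\<^sup>p\<^sup>+\<^sup>1\<close>, and the sum in the hypothesis is the
  coordinate of its image under \<open>\<Sum>\<^sub>i (e\<^sub>i \<and>) \<otimes> \<iota>\<^sub>i\<close> at the pair \<open>(S, T)\<close>, with \<open>\<iota>\<^sub>i\<close> the contraction by
  \<open>e\<^sub>i\<close>. Moving \<open>i\<close> from one index set to the other changes neither their intersection \<open>C\<close> nor their
  symmetric difference \<open>D\<close>. The two shuffle signs count the elements below \<open>i\<close> in both sets; those in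
  \<open>C\<close> are counted twice and cancel, so that the product \<open>\<epsilon> i\<close> depends on \<open>i\<close> and \<open>D\<close> only.
\<close>

lemma polarization_injective:
  fixes u :: "nat set \<Rightarrow> nat set \<Rightarrow> 'a::field_char_0"
  assumes V: "finite V"
    and ker: "\<And>S T. S \<subseteq> V \<Longrightarrow> T \<subseteq> V \<Longrightarrow> card S = Suc p \<Longrightarrow> card T = p \<Longrightarrow>
      (\<Sum>i\<in>S - T. shuffle_sign {i} (S - {i}) * shuffle_sign {i} T * u (S - {i}) (insert i T)) = 0"
    and S: "S \<subseteq> V" "card S = p" and T: "T \<subseteq> V" "card T = Suc p"
  shows "u S T = 0"
proof -
  define C D where "C = S \<inter> T" and "D = (S - T) \<union> (T - S)"
  define \<epsilon> :: "nat \<Rightarrow> 'a" where "\<epsilon> i = shuffle_sign {i} (D - {i})" for i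
  \<comment> \<open>The factor in front of \<open>u\<close> is the rescaling that absorbs the signs \<open>\<epsilon> i\<close>.\<close>
  define g where "g B = (\<Prod>i\<in>B. \<epsilon> i) * u (C \<union> B) (C \<union> (D - B))" for B
  have "finite S" "finite T" using V S T finite_subset by auto
  then have fin: "finite S" "finite T" "finite C" "finite D"
    by (auto simp: C_def D_def)
  have CD: "C \<inter> D = {}" "C \<subseteq> V" "D \<subseteq> V"
    using S T by (auto simp: C_def D_def)
  have eps: "\<epsilon> i * \<epsilon> i = 1" for i
    by (simp add: \<epsilon>_def shuffle_sign_square)
  have cS: "card C + card (S - T) = p" and cT: "card C + card (T - S) = Suc p"
    using card_Int_Diff[of S T] card_Int_Diff[of T S] S T fin by (auto simp: C_def Int_commute)
  have cD: "card D = card (S - T) + card (T - S)"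
    unfolding D_def using fin by (intro card_Un_disjoint) auto
  define m where "m = card (S - T)"
  have "g (S - T) = 0"
  proof (rule boolean_lattice_up_injective[of D m])
    fix A assume A: "A \<subseteq> D" "card A = Suc m"
    have finA: "finite A" using A fin finite_subset by blast
    let ?S = "C \<union> A" and ?T = "C \<union> (D - A)"
    have "card ?S = card C + card A"
      using A CD finA fin by (intro card_Un_disjoint) auto
    then have 1: "card ?S = Suc p" using A cS by (simp add: m_def)
    have "card ?T = card C + card (D - A)"
      using CD fin by (intro card_Un_disjoint) auto
    also have "card (D - A) = card D - card A"
      using A finA by (intro card_Diff_subset) auto
    finally have 2: "card ?T = p" using A cS cT cD by (simp add: m_def)
    have sgn: "shuffle_sign {i} (?S - {i}) * shuffle_sign {i} ?T = \<epsilon> i" if i: "i \<in> A" for i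
    proof -
      have iC: "i \<notin> C" using i A CD by auto
      have "?S - {i} = C \<union> (A - {i})" using iC by auto
      then have a: "shuffle_sign {i} (?S - {i}) =
          (shuffle_sign {i} C * shuffle_sign {i} (A - {i}) :: 'a)"
        using shuffle_sign_union_right[of "{i}" C "A - {i}"] fin finA A CD by auto
      have b: "shuffle_sign {i} ?T = (shuffle_sign {i} C * shuffle_sign {i} (D - A) :: 'a)"
        using shuffle_sign_union_right[of "{i}" C "D - A"] fin CD by auto
      have "D - {i} = (A - {i}) \<union> (D - A)" using A i by auto
      then have c: "\<epsilon> i = shuffle_sign {i} (A - {i}) * shuffle_sign {i} (D - A)"
        unfolding \<epsilon>_def using shuffle_sign_union_right[of "{i}" "A - {i}" "D - A"] fin finA by auto
      have "shuffle_sign {i} (?S - {i}) * shuffle_sign {i} ?T =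
          (shuffle_sign {i} C * shuffle_sign {i} C) * \<epsilon> i"
        unfolding a b c by (simp only: mult_ac)
      then show ?thesis by (simp add: shuffle_sign_square)
    qed
    have "?S - ?T = A" using A CD by auto
    then have "0 = (\<Prod>i\<in>A. \<epsilon> i) * (\<Sum>i\<in>A. \<epsilon> i * u (?S - {i}) (insert i ?T))"
      using ker[of ?S ?T] 1 2 A CD by (auto simp: sgn subset_iff)
    also have "\<dots> = (\<Sum>i\<in>A. g (A - {i}))"
      unfolding sum_distrib_left
    proof (rule sum.cong[OF refl])
      fix i assume i: "i \<in> A"
      have "?S - {i} = C \<union> (A - {i})" "insert i ?T = C \<union> (D - (A - {i}))"
        using i A CD by auto
      moreover have "(\<Prod>k\<in>A. \<epsilon> k) = \<epsilon> i * (\<Prod>k\<in>A - {i}. \<epsilon> k)"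
        using finA i by (rule prod.remove)
      moreover have "\<epsilon> i * P * (\<epsilon> i * w) = P * w" for P w
        using eps[of i] by (metis mult.assoc mult.commute mult_1)
      ultimately show "(\<Prod>i\<in>A. \<epsilon> i) * (\<epsilon> i * u (?S - {i}) (insert i ?T)) = g (A - {i})"
        by (simp add: g_def)
    qed
    finally show "(\<Sum>i\<in>A. g (A - {i})) = 0" by simp
  qed (use fin cS cT cD in \<open>auto simp: m_def D_def\<close>)
  moreover have "(\<Prod>i\<in>S - T. \<epsilon> i) \<noteq> 0"
    using fin eps by (auto simp: prod_zero_iff) (metis mult_zero_left zero_neq_one)
  moreover have "C \<union> (S - T) = S" "C \<union> (D - (S - T)) = T"
    by (auto simp: C_def D_def)
  ultimately show ?thesis by (simp add: g_def)
qed

section \<open>Matrix ranks from columns and kernels\<close>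

lemma mrank_eq_dim_if_trivial_kernel:
  fixes A :: "'a::field mat"
  assumes A: "A \<in> carrier_mat N N"
    and ker: "\<And>w. w \<in> carrier_vec N \<Longrightarrow> A *\<^sub>v w = 0\<^sub>v N \<Longrightarrow> w = 0\<^sub>v N"
  shows "mrank A = N"
proof -
  have "det A \<noteq> 0"
    using det_0_iff_vec_prod_zero_field[OF A] ker by auto
  then show ?thesis
    using vec_space.det_rank_iff[OF A] A by (simp add: mrank_def)
qed

lemma (in vec_space) linear_combination_in_span:
  assumes W: "W \<subseteq> carrier_vec n" and I: "finite I" and f: "\<And>i. i \<in> I \<Longrightarrow> f i \<in> span W"
  shows "vec n (\<lambda>r. \<Sum>i\<in>I. c i * f i $ r) \<in> span W"
  using I f
proof (induction I rule: finite_induct)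
  case empty
  have "vec n (\<lambda>r. \<Sum>i\<in>{}. c i * f i $ r) = 0\<^sub>v n" by auto
  also have "\<dots> = lincomb (\<lambda>_. 0) {}" by (simp add: lincomb_def)
  also have "\<dots> \<in> span W" by (rule in_spanI[OF refl]) auto
  finally show ?case .
next
  case (insert i I)
  have car: "f i \<in> carrier_vec n" using insert.prems W span_closed by blast
  have "vec n (\<lambda>r. \<Sum>k\<in>insert i I. c k * f k $ r) = c i \<cdot>\<^sub>v f i + vec n (\<lambda>r. \<Sum>k\<in>I. c k * f k $ r)"
    using insert.hyps car by (intro eq_vecI) auto
  moreover have "c i \<cdot>\<^sub>v f i \<in> span W" using insert.prems W by (intro smult_in_span) auto
  ultimately show ?case using insert W by (auto intro!: span_add1[simplified])
qed

text \<open>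
  A kernel vector \<open>w\<close> with \<open>w\<^sub>j \<noteq> 0\<close> is a linear relation between columns that can be solved for
  column \<open>j\<close>; so the columns with indices in \<open>J\<close> span the column space.
\<close>

lemma mrank_le_card_spanning_columns:
  fixes A :: "'a::field mat"
  assumes A: "A \<in> carrier_mat nr nc" and J: "J \<subseteq> {..<nc}"
    and rel: "\<And>j. j < nc \<Longrightarrow> j \<notin> J \<Longrightarrow> \<exists>w \<in> carrier_vec nc. A *\<^sub>v w = 0\<^sub>v nr \<and> w $ j \<noteq> 0 \<and>
      (\<forall>i<nc. w $ i \<noteq> 0 \<longrightarrow> i = j \<or> i \<in> J)"
  shows "mrank A \<le> card J"
proof -
  interpret vec_space "TYPE('a)" nr .
  define W where "W = col A ` J"
  have finJ: "finite J" using J finite_subset by blast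
  have W: "W \<subseteq> carrier_vec nr" "finite W" "W \<subseteq> set (cols A)"
    using A J finJ by (auto simp: W_def cols_def)
  have in_span: "col A j \<in> span W" if j: "j < nc" for j
  proof (cases "j \<in> J")
    case True
    then have "col A j \<in> W" by (simp add: W_def)
    then show ?thesis using in_own_span[OF W(1)] by auto
  next
    case False
    obtain w where w: "w \<in> carrier_vec nc" "A *\<^sub>v w = 0\<^sub>v nr" "w $ j \<noteq> 0"
        "\<And>i. i < nc \<Longrightarrow> w $ i \<noteq> 0 \<Longrightarrow> i = j \<or> i \<in> J"
      using rel[OF j False] by auto
    have "col A j = vec nr (\<lambda>r. \<Sum>i\<in>J. (- w $ i / w $ j) * col A i $ r)"
    proof (rule eq_vecI)
      fix r assume "r < dim_vec (vec nr (\<lambda>r. \<Sum>i\<in>J. (- w $ i / w $ j) * col A i $ r))"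
      then have r: "r < nr" by simp
      have "0 = (A *\<^sub>v w) $ r" using w r by simp
      also have "\<dots> = (\<Sum>i<nc. A $$ (r, i) * w $ i)"
        using A w(1) r by (auto simp: scalar_prod_def atLeast0LessThan intro!: sum.cong)
      also have "\<dots> = (\<Sum>i\<in>insert j J. A $$ (r, i) * w $ i)"
        using w(4) J j by (intro sum.mono_neutral_right) auto
      also have "\<dots> = A $$ (r, j) * w $ j + (\<Sum>i\<in>J. A $$ (r, i) * w $ i)"
        using finJ False by simp
      finally have "A $$ (r, j) = - (\<Sum>i\<in>J. A $$ (r, i) * w $ i) / w $ j"
        using w(3) by (simp add: field_simps eq_neg_iff_add_eq_0)
      also have "\<dots> = (\<Sum>i\<in>J. (- w $ i / w $ j) * col A i $ r)"
        unfolding sum_negf[symmetric] sum_divide_distrib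
        using A J r by (intro sum.cong) auto
      finally show "col A j $ r = vec nr (\<lambda>r. \<Sum>i\<in>J. (- w $ i / w $ j) * col A i $ r) $ r"
        using A r j by simp
    qed (use A in simp)
    moreover have "vec nr (\<lambda>r. \<Sum>i\<in>J. (- w $ i / w $ j) * col A i $ r) \<in> span W"
      using W finJ in_own_span[OF W(1)] by (intro linear_combination_in_span) (auto simp: W_def)
    ultimately show ?thesis by simp
  qed
  have "set (cols A) \<subseteq> span W"
    using in_span A by (auto simp: cols_def)
  then have "span (set (cols A)) \<subseteq> span W"
    using W by (intro span_subsetI)
  moreover have "span W \<subseteq> span (set (cols A))"
    using W(3) by (rule span_is_monotone)
  ultimately have sp: "span (set (cols A)) = span W" by blast
  obtain U where U: "maximal U (\<lambda>T. T \<subseteq> W \<and> lin_indpt T)"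
    using maximal_exists[of "\<lambda>T. T \<subseteq> W \<and> lin_indpt T" "card W" "{}"] W(2)
    by (meson card_mono empty_iff empty_subsetI finite_lin_indpt2 rev_finite_subset)
  have "rank A = card U"
    unfolding rank_def sp using W U by (intro dim_span) auto
  also have "\<dots> \<le> card W"
    using U W(2) by (auto simp: maximal_def intro: card_mono)
  also have "\<dots> \<le> card J"
    unfolding W_def using finJ by (rule card_image_le)
  finally show ?thesis using A by (simp add: mrank_def)
qed

lemma mrank_ge_card_unit_columns:
  fixes A :: "'a::field mat"
  assumes A: "A \<in> carrier_mat nr nc" and J: "J \<subseteq> {..<nc}" and inj: "inj_on h J"
    and h: "\<And>j. j \<in> J \<Longrightarrow> h j < nr" and col: "\<And>j. j \<in> J \<Longrightarrow> col A j = unit_vec nr (h j)"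
  shows "card J \<le> mrank A"
proof -
  interpret vec_space "TYPE('a)" nr .
  have sub: "col A ` J \<subseteq> set (unit_vecs nr)"
    using h col by (auto simp: unit_vecs_def)
  have "lin_indpt (set (unit_vecs nr))"
    using unit_vecs_basis by (simp add: basis_def)
  then have "lin_indpt (col A ` J)"
    using sub by (rule subset_li_is_li)
  moreover have "col A ` J \<subseteq> set (cols A)"
    using A J by (auto simp: cols_def)
  ultimately have "card (col A ` J) \<le> rank A"
    using A by (intro rank_ge_card_indpt) auto
  moreover have "inj_on (col A) J"
  proof (rule inj_onI)
    fix i j assume ij: "i \<in> J" "j \<in> J" "col A i = col A j"
    then have "(unit_vec nr (h i) :: 'a vec) = unit_vec nr (h j)" using col by simp
    then have "h i = h j" using h ij unit_vec_eq[of "h i" nr "h j"] by auto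
    then show "i = j" using inj ij by (auto dest: inj_onD)
  qed
  ultimately show ?thesis using A by (simp add: mrank_def card_image)
qed

section \<open>The matrices of the basis vectors\<close>

lemma ext_of_vec_unit_vec: "i < n \<Longrightarrow> ext_of_vec (unit_vec n i :: 'a::comm_ring_1 vec) = ext_unit {i}"
proof (rule ext)
  fix S assume i: "i < n"
  have "ext_of_vec (unit_vec n i :: 'a vec) S = (\<Sum>j<n. if j = i then ext_unit {i} S else 0)"
    unfolding ext_of_vec_def using i by (intro sum.cong) auto
  then show "ext_of_vec (unit_vec n i :: 'a vec) S = ext_unit {i} S" using i by simp
qed

abbreviation basis_wedge :: "nat \<Rightarrow> nat \<Rightarrow> nat \<Rightarrow> 'a::comm_ring_1 mat" where
  "basis_wedge n p i \<equiv> ext_matrix n p (p + 1) (left_wedge (unit_vec n i))"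

lemma ext_basis_nth:
  assumes "j < n choose p"
  shows "ext_basis n p ! j \<subseteq> {0..<n}" "card (ext_basis n p ! j) = p" "finite (ext_basis n p ! j)"
proof -
  have "ext_basis n p ! j \<in> set (ext_basis n p)"
    using assms by (intro nth_mem) (simp add: length_ext_basis)
  then show "ext_basis n p ! j \<subseteq> {0..<n}" "card (ext_basis n p ! j) = p"
    by (auto simp: set_ext_basis)
  then show "finite (ext_basis n p ! j)" using finite_subset by blast
qed

lemma bij_ext_basis:
  "bij_betw (\<lambda>j. ext_basis n p ! j) {..<n choose p} {S. S \<subseteq> {0..<n} \<and> card S = p}"
  using bij_betw_nth[OF distinct_ext_basis[of n p] refl set_ext_basis[symmetric]]
  by (simp add: length_ext_basis)

lemma basis_wedge_carrier:
  "(basis_wedge n p i :: 'a::comm_ring_1 mat) \<in> carrier_mat (n choose (p + 1)) (n choose p)"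
  by (simp add: ext_matrix_def length_ext_basis)

lemma basis_wedge_entry:
  assumes i: "i < n" and r: "r < n choose (p + 1)" and c: "c < n choose p"
  shows "(basis_wedge n p i :: 'a::comm_ring_1 mat) $$ (r, c) =
    (if i \<notin> ext_basis n p ! c \<and> ext_basis n (p + 1) ! r = insert i (ext_basis n p ! c)
     then shuffle_sign {i} (ext_basis n p ! c) else 0)"
  using ext_basis_nth[OF c] r c
  by (simp add: ext_matrix_def length_ext_basis left_wedge_def ext_of_vec_unit_vec[OF i]
      wedge_ext_unit) (simp add: ext_unit_def)

text \<open>
  Row \<open>S\<close> of \<open>L\<^sub>i\<close> has at most one nonzero entry, in column \<open>S - {i}\<close>.
\<close>

lemma basis_wedge_row_sum:
  fixes x :: "nat set \<Rightarrow> 'a::comm_ring_1"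
  assumes i: "i < n" and r: "r < n choose (p + 1)"
  defines "S \<equiv> ext_basis n (p + 1) ! r"
  shows "(\<Sum>c<n choose p. basis_wedge n p i $$ (r, c) * x (ext_basis n p ! c)) =
    (if i \<in> S then shuffle_sign {i} (S - {i}) * x (S - {i}) else 0)"
proof -
  let ?F = "\<lambda>A. (if i \<notin> A \<and> S = insert i A then shuffle_sign {i} A else 0) * x A"
  let ?B = "{A. A \<subseteq> {0..<n} \<and> card A = p}"
  have S: "S \<subseteq> {0..<n}" "card S = p + 1" "finite S"
    using ext_basis_nth[OF r] by (simp_all add: S_def)
  have "(\<Sum>c<n choose p. basis_wedge n p i $$ (r, c) * x (ext_basis n p ! c)) =
      (\<Sum>c<n choose p. ?F (ext_basis n p ! c))"
    using basis_wedge_entry[OF i r, where 'a = 'a] by (intro sum.cong) (auto simp: S_def)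
  also have "\<dots> = (\<Sum>A\<in>?B. ?F A)"
    by (rule sum.reindex_bij_betw[OF bij_ext_basis])
  also have "\<dots> = (\<Sum>A\<in>?B. if A = S - {i} then
      (if i \<in> S then shuffle_sign {i} (S - {i}) * x (S - {i}) else 0) else 0)"
    by (rule sum.cong) auto
  also have "\<dots> = (if i \<in> S then shuffle_sign {i} (S - {i}) * x (S - {i}) else 0)"
  proof -
    have "i \<in> S \<Longrightarrow> S - {i} \<in> ?B" using S by auto
    moreover have "finite ?B" by simp
    ultimately show ?thesis by (auto simp: sum.delta)
  qed
  finally show ?thesis .
qed

text \<open>
  Column \<open>T\<close> of \<open>L\<^sub>i\<close> has at most one nonzero entry, in row \<open>T \<union> {i}\<close>. Read as a statement about the
  transpose, this describes the contraction by \<open>e\<^sub>i\<close>.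
\<close>

lemma basis_wedge_column_sum:
  fixes x :: "nat set \<Rightarrow> 'a::comm_ring_1"
  assumes i: "i < n" and c: "c < n choose p"
  defines "T \<equiv> ext_basis n p ! c"
  shows "(\<Sum>r<n choose (p + 1). basis_wedge n p i $$ (r, c) * x (ext_basis n (p + 1) ! r)) =
    (if i \<notin> T then shuffle_sign {i} T * x (insert i T) else 0)"
proof -
  let ?F = "\<lambda>A. (if i \<notin> T \<and> A = insert i T then shuffle_sign {i} T else 0) * x A"
  let ?B = "{A. A \<subseteq> {0..<n} \<and> card A = p + 1}"
  have T: "T \<subseteq> {0..<n}" "card T = p" "finite T"
    using ext_basis_nth[OF c] by (simp_all add: T_def)
  have "(\<Sum>r<n choose (p + 1). basis_wedge n p i $$ (r, c) * x (ext_basis n (p + 1) ! r)) =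
      (\<Sum>r<n choose (p + 1). ?F (ext_basis n (p + 1) ! r))"
    using basis_wedge_entry[OF i _ c, where 'a = 'a] by (intro sum.cong) (auto simp: T_def)
  also have "\<dots> = (\<Sum>A\<in>?B. ?F A)"
    by (rule sum.reindex_bij_betw[OF bij_ext_basis])
  also have "\<dots> = (\<Sum>A\<in>?B. if A = insert i T then
      (if i \<notin> T then shuffle_sign {i} T * x (insert i T) else 0) else 0)"
    by (rule sum.cong) auto
  also have "\<dots> = (if i \<notin> T then shuffle_sign {i} T * x (insert i T) else 0)"
  proof -
    have "i \<notin> T \<Longrightarrow> insert i T \<in> ?B" using T i by auto
    moreover have "finite ?B" by simp
    ultimately show ?thesis by (auto simp: sum.delta)
  qed
  finally show ?thesis .
qed

section \<open>The rank of the wedge space\<close>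

lemma card_indices_avoiding:
  assumes "k < n"
  shows "card {j. j < n choose p \<and> k \<notin> ext_basis n p ! j} = (n - 1) choose p"
proof -
  let ?f = "\<lambda>j. ext_basis n p ! j"
  have "?f ` {j. j < n choose p \<and> k \<notin> ?f j} = {S \<in> ?f ` {..<n choose p}. k \<notin> S}"
    by auto
  also have "\<dots> = {S. S \<subseteq> {0..<n} - {k} \<and> card S = p}"
    unfolding bij_betw_imp_surj_on[OF bij_ext_basis] by auto
  finally have "bij_betw ?f {j. j < n choose p \<and> k \<notin> ?f j} {S. S \<subseteq> {0..<n} - {k} \<and> card S = p}"
    using bij_betw_imp_inj_on[OF bij_ext_basis[of n p]]
    unfolding bij_betw_def by (auto elim: inj_on_subset)
  then have "card {j. j < n choose p \<and> k \<notin> ext_basis n p ! j} =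
      card {S. S \<subseteq> {0..<n} - {k} \<and> card S = p}"
    by (rule bij_betw_same_card)
  also have "\<dots> = card ({0..<n} - {k}) choose p"
    by (rule n_subsets) simp
  finally show ?thesis using assms by simp
qed

lemma wedge_vec_unit_apply:
  fixes v :: "'a::comm_ring_1 vec"
  assumes "finite T"
  shows "wedge (ext_of_vec v) (ext_unit T) S =
    (\<Sum>i<dim_vec v. if i \<notin> T \<and> S = insert i T then v $ i * shuffle_sign {i} T else 0)"
proof -
  have "wedge (ext_of_vec v) (ext_unit T) S =
      (\<Sum>i<dim_vec v. v $ i * wedge (ext_unit {i}) (ext_unit T) S)"
    by (simp add: ext_of_vec_def wedge_sum_left wedge_distrib)
  also have "\<dots> = (\<Sum>i<dim_vec v. if i \<notin> T \<and> S = insert i T then v $ i * shuffle_sign {i} T else 0)"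
    unfolding wedge_ext_unit[OF finite.insertI[OF finite.emptyI] assms]
    by (intro sum.cong) (auto simp: ext_unit_def)
  finally show ?thesis .
qed

lemma ext_unit_power: "S \<subseteq> {0..<n} \<Longrightarrow> card S = p \<Longrightarrow> (ext_unit S :: 'a::zero_neq_one ext) \<in> ext_power n p"
  by (auto simp: ext_power_def ext_unit_def)

text \<open>
  The relation that expresses the column with index set \<open>S\<close> of \<open>L\<^sub>v\<close> through columns avoiding \<open>k\<close>.
  The witness for \<open>v \<noteq> 0\<close> is \<open>v \<and> e\<^sub>T\<close> with \<open>T = S - {k}\<close>: it is annihilated by \<open>v\<close>, and among its
  terms \<open>v\<^sub>i e\<^sub>i \<and> e\<^sub>T\<close> only the one with \<open>i = k\<close> involves the index \<open>k\<close>. Admitting \<open>v = 0\<close>, where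
  \<open>e\<^sub>S\<close> itself will do, makes the rank bound uniform in \<open>v\<close>.
\<close>

lemma wedge_kernel_element:
  fixes v :: "'a::field vec"
  assumes v: "v \<in> carrier_vec n" and k: "v = 0\<^sub>v n \<or> v $ k \<noteq> 0" and kn: "k < n"
    and S: "S \<subseteq> {0..<n}" "card S = p" "k \<in> S"
  shows "\<exists>x \<in> ext_power n p. left_wedge v x = (\<lambda>_. 0) \<and> x S \<noteq> 0 \<and>
    (\<forall>S'. x S' \<noteq> 0 \<longrightarrow> S' = S \<or> k \<notin> S')"
proof (cases "v = 0\<^sub>v n")
  case True
  then have "left_wedge v (ext_unit S) = (\<lambda>_. 0)"
    by (simp add: left_wedge_def ext_of_vec_def wedge_def)
  moreover have "(ext_unit S :: 'a ext) \<in> ext_power n p" using S by (simp add: ext_unit_power)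
  ultimately show ?thesis by (intro bexI[of _ "ext_unit S"]) (auto simp: ext_unit_def)
next
  case False
  define T where "T = S - {k}"
  define x where "x = wedge (ext_of_vec v) (ext_unit T)"
  have finS: "finite S" using S finite_subset by blast
  then have T: "finite T" "T \<subseteq> {0..<n}" "card T = p - 1" "k \<notin> T" "insert k T = S" "p > 0"
    using S by (auto simp: T_def card_gt_0_iff)
  have apply_x: "x S' = (\<Sum>i<n. if i \<notin> T \<and> S' = insert i T then v $ i * shuffle_sign {i} T else 0)" for S'
    using wedge_vec_unit_apply[OF T(1), of v S'] v by (simp add: x_def)
  have "x \<in> ext_power n (1 + (p - 1))"
    unfolding x_def using v T by (intro wedge_ext_power ext_of_vec_ext_power ext_unit_power)
  then have "x \<in> ext_power n p" using T by simp
  moreover have "left_wedge v x = (\<lambda>_. 0)"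
    unfolding left_wedge_def x_def wedge_assoc[symmetric] wedge_square_zero by (simp add: wedge_def)
  moreover have "x S \<noteq> 0"
  proof -
    have "x S = (\<Sum>i<n. if i = k then v $ k * shuffle_sign {k} T else 0)"
      unfolding apply_x using T by (intro sum.cong) auto
    then show ?thesis using kn k False by (simp add: shuffle_sign_def)
  qed
  moreover have "S' = S \<or> k \<notin> S'" if "x S' \<noteq> 0" for S'
  proof -
    have "\<exists>i. i \<notin> T \<and> S' = insert i T"
      using that unfolding apply_x by (rule contrapos_np) (intro sum.neutral, auto)
    then obtain i where "i \<notin> T" "S' = insert i T" by blast
    then show ?thesis using T by auto
  qed
  ultimately show ?thesis by blast
qed

lemma mrank_left_wedge_le:
  fixes v :: "'a::field vec"
  assumes v: "v \<in> carrier_vec n" and n: "n > 0"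
  shows "mrank (ext_matrix n p (p + 1) (left_wedge v)) \<le> (n - 1) choose p"
proof -
  let ?A = "ext_matrix n p (p + 1) (left_wedge v)"
  obtain k where k: "k < n" "v = 0\<^sub>v n \<or> v $ k \<noteq> 0"
    using v n by (metis carrier_vecD eq_vecI index_zero_vec)
  define J where "J = {j. j < n choose p \<and> k \<notin> ext_basis n p ! j}"
  have "mrank ?A \<le> card J"
  proof (rule mrank_le_card_spanning_columns)
    show "?A \<in> carrier_mat (n choose (p + 1)) (n choose p)"
      by (simp add: ext_matrix_def length_ext_basis)
    show "J \<subseteq> {..<n choose p}" by (auto simp: J_def)
    fix j assume j: "j < n choose p" "j \<notin> J"
    let ?S = "ext_basis n p ! j"
    obtain x where x: "x \<in> ext_power n p" "left_wedge v x = (\<lambda>_. 0)" "x ?S \<noteq> 0"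
      "\<And>S'. x S' \<noteq> 0 \<Longrightarrow> S' = ?S \<or> k \<notin> S'"
      using wedge_kernel_element[OF v k(2,1), of ?S p] ext_basis_nth[OF j(1)] j by (auto simp: J_def)
    let ?w = "vec (n choose p) (\<lambda>i. x (ext_basis n p ! i))"
    have "?A *\<^sub>v ?w = 0\<^sub>v (n choose (p + 1))"
      unfolding ext_matrix_left_wedge[OF x(1)] x(2) by auto
    moreover have "i = j \<or> i \<in> J" if "i < n choose p" "?w $ i \<noteq> 0" for i
    proof -
      have "ext_basis n p ! i = ?S \<or> k \<notin> ext_basis n p ! i"
        using x(4) that by simp
      then show ?thesis
        using that j distinct_ext_basis[of n p] length_ext_basis[of n p]
        by (auto simp: J_def nth_eq_iff_index_eq)
    qed
    ultimately show "\<exists>w\<in>carrier_vec (n choose p). ?A *\<^sub>v w = 0\<^sub>v (n choose (p + 1)) \<and> w $ j \<noteq> 0 \<and>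
      (\<forall>i<n choose p. w $ i \<noteq> 0 \<longrightarrow> i = j \<or> i \<in> J)"
      using x(3) j by (intro bexI[of _ ?w]) auto
  qed
  also have "card J = (n - 1) choose p"
    unfolding J_def using k(1) by (rule card_indices_avoiding)
  finally show ?thesis .
qed

text \<open>
  The vector \<open>e\<^sub>0 \<and> e\<^sub>S\<close> with \<open>0 \<notin> S\<close> is the basis vector of \<open>S \<union> {0}\<close> without a sign, because \<open>0\<close> is
  the least index.
\<close>

lemma mrank_basis_wedge_ge:
  assumes n: "n > 0"
  shows "(n - 1) choose p \<le> mrank (basis_wedge n p 0 :: 'a::field mat)"
proof -
  let ?A = "basis_wedge n p 0 :: 'a mat"
  define J where "J = {j. j < n choose p \<and> 0 \<notin> ext_basis n p ! j}"
  have "\<exists>r. r < n choose (p + 1) \<and> ext_basis n (p + 1) ! r = insert 0 (ext_basis n p ! j)"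
    if "j \<in> J" for j
  proof -
    have "insert 0 (ext_basis n p ! j) \<in> {S. S \<subseteq> {0..<n} \<and> card S = p + 1}"
      using that ext_basis_nth[of j n p] n by (auto simp: J_def)
    then show ?thesis
      unfolding bij_betw_imp_surj_on[OF bij_ext_basis, symmetric] by auto
  qed
  then obtain h where h: "\<And>j. j \<in> J \<Longrightarrow> h j < n choose (p + 1)"
    "\<And>j. j \<in> J \<Longrightarrow> ext_basis n (p + 1) ! h j = insert 0 (ext_basis n p ! j)"
    by metis
  have "card J \<le> mrank ?A"
  proof (rule mrank_ge_card_unit_columns)
    show "?A \<in> carrier_mat (n choose (p + 1)) (n choose p)" by (rule basis_wedge_carrier)
    show "J \<subseteq> {..<n choose p}" by (auto simp: J_def)
    show "inj_on h J"
    proof (rule inj_onI)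
      fix i j assume ij: "i \<in> J" "j \<in> J" "h i = h j"
      then have "insert 0 (ext_basis n p ! i) = insert 0 (ext_basis n p ! j)"
        using h(2) by metis
      then have "ext_basis n p ! i = ext_basis n p ! j"
        using ij by (simp add: J_def insert_ident)
      then show "i = j"
        using ij distinct_ext_basis[of n p] length_ext_basis[of n p]
        by (auto simp: J_def nth_eq_iff_index_eq)
    qed
    show "h j < n choose (p + 1)" if "j \<in> J" for j using h that by simp
    fix j assume j: "j \<in> J"
    have sgn: "shuffle_sign {0} S = (1 :: 'a)" for S
    proof -
      have "{(a, b) \<in> {0 :: nat} \<times> S. b < a} = {}" by auto
      then show ?thesis unfolding shuffle_sign_def by (simp only: card.empty power_0)
    qed
    show "col ?A j = unit_vec (n choose (p + 1)) (h j)"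
    proof (rule eq_vecI)
      fix r assume "r < dim_vec (unit_vec (n choose (p + 1)) (h j))"
      then have r: "r < n choose (p + 1)" by simp
      have "r = h j \<longleftrightarrow> ext_basis n (p + 1) ! r = insert 0 (ext_basis n p ! j)"
        using h[OF j] r distinct_ext_basis[of n "p + 1"] length_ext_basis[of n "p + 1"]
        by (metis nth_eq_iff_index_eq)
      moreover have "col ?A j $ r = ?A $$ (r, j)"
        using r j basis_wedge_carrier[of n p 0, where 'a = 'a] by (simp add: J_def)
      ultimately show "col ?A j $ r = unit_vec (n choose (p + 1)) (h j) $ r"
        using basis_wedge_entry[OF n r, of j, where 'a = 'a] j h[OF j] r by (auto simp: J_def sgn)
    qed (use basis_wedge_carrier[of n p 0, where 'a = 'a] in simp)
  qed
  moreover have "card J = (n - 1) choose p"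
    unfolding J_def using n by (rule card_indices_avoiding)
  ultimately show ?thesis by simp
qed

lemma rk_wedge_space:
  assumes "n > 0"
  shows "rk (wedge_space p n :: 'a::field mat set) = (n - 1) choose p"
proof (rule antisym)
  note attained = rk_attained_and_bound[OF wedge_space_carrier[of p n, where 'a = 'a]
      wedge_space_nonempty[of p n]]
  show "rk (wedge_space p n :: 'a mat set) \<le> (n - 1) choose p"
    using attained(1) mrank_left_wedge_le[OF _ assms, where 'a = 'a]
    by (auto simp: wedge_space_def)
  have "(basis_wedge n p 0 :: 'a mat) \<in> wedge_space p n"
    by (simp add: wedge_space_def)
  then show "(n - 1) choose p \<le> rk (wedge_space p n :: 'a mat set)"
    using attained(2) mrank_basis_wedge_ge[OF assms, of p, where 'a = 'a] le_trans by blast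
qed

section \<open>A blow-up of full rank\<close>

lemma foldr_add_mat_carrier:
  assumes "\<And>i. i \<in> set xs \<Longrightarrow> f i \<in> carrier_mat a b"
  shows "foldr (+) (map f xs) (0\<^sub>m a b) \<in> carrier_mat a b"
  using assms by (induction xs) auto

lemma foldr_add_mat_index:
  assumes "\<And>i. i \<in> set xs \<Longrightarrow> f i \<in> carrier_mat a b" and "r < a" "c < b"
  shows "foldr (+) (map f xs) (0\<^sub>m a b) $$ (r, c) = (\<Sum>i\<leftarrow>xs. f i $$ (r, c))"
  using assms(1)
proof (induction xs)
  case (Cons i xs)
  have "foldr (+) (map f xs) (0\<^sub>m a b) \<in> carrier_mat a b"
    using Cons.prems by (intro foldr_add_mat_carrier) auto
  then show ?case using Cons assms(2,3) by simp
qed (use assms(2,3) in simp)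

text \<open>
  The matrix \<open>\<Sum>\<^sub>i A\<^sub>i \<otimes> T\<^sub>i\<close> is invertible as soon as the linear map \<open>W \<mapsto> \<Sum>\<^sub>i A\<^sub>i W T\<^sub>i\<^sup>T\<close> on \<open>d\<close> by \<open>d\<close>
  matrices is injective: a vector of length \<open>d\<^sup>2\<close> is a matrix \<open>W\<close> whose rows are written one after the
  other, and under this identification the two maps agree.
\<close>

lemma blow_up_full_rank:
  fixes A T :: "nat \<Rightarrow> 'a::field mat"
  assumes A: "\<And>i. i < m \<Longrightarrow> A i \<in> X" and X: "X \<subseteq> carrier_mat d d"
    and T: "\<And>i. i < m \<Longrightarrow> T i \<in> carrier_mat d d" and d: "d > 0"
    and ker: "\<And>W s t. (\<And>a b. a < d \<Longrightarrow> b < d \<Longrightarrow>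
        (\<Sum>i<m. \<Sum>s<d. A i $$ (a, s) * (\<Sum>t<d. T i $$ (b, t) * W s t)) = 0) \<Longrightarrow>
        s < d \<Longrightarrow> t < d \<Longrightarrow> W s t = 0"
  shows "rk (blow_up d d d X) = d * d"
proof -
  have Ac: "A i \<in> carrier_mat d d" if "i < m" for i using A X that by auto
  define M where "M = foldr (+) (map (\<lambda>i. kron (A i) (T i)) [0..<m]) (0\<^sub>m (d * d) (d * d))"
  have M_blow: "M \<in> blow_up d d d X"
    unfolding blow_up_def M_def
    by (rule CollectI, rule exI[of _ "map (\<lambda>i. (A i, T i)) [0..<m]"])
      (use A T in \<open>auto simp: comp_def\<close>)
  have kc: "kron (A i) (T i) \<in> carrier_mat (d * d) (d * d)" if "i < m" for i
    using Ac T that by (intro kron_carrier)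
  have Mc: "M \<in> carrier_mat (d * d) (d * d)"
    unfolding M_def using kc by (intro foldr_add_mat_carrier) auto
  have div_less: "q div d < d" "q mod d < d" if "q < d * d" for q
    using that d by (auto simp: less_mult_imp_div_less)
  have comb_less: "a * d + b < d * d" if "a < d" "b < d" for a b
  proof -
    have "a * d + b < Suc a * d" using that by simp
    also have "\<dots> \<le> d * d" using that by (intro mult_le_mono1) simp
    finally show ?thesis .
  qed
  have M_entry: "M $$ (r, c) =
      (\<Sum>i<m. A i $$ (r div d, c div d) * T i $$ (r mod d, c mod d))"
    if rc: "r < d * d" "c < d * d" for r c
  proof -
    have "M $$ (r, c) = (\<Sum>i\<leftarrow>[0..<m]. kron (A i) (T i) $$ (r, c))"
      unfolding M_def using kc rc by (intro foldr_add_mat_index) auto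
    also have "\<dots> = (\<Sum>i<m. kron (A i) (T i) $$ (r, c))"
      by (simp add: interv_sum_list_conv_sum_set_nat atLeast0LessThan)
    also have "\<dots> = (\<Sum>i<m. A i $$ (r div d, c div d) * T i $$ (r mod d, c mod d))"
    proof (rule sum.cong[OF refl])
      fix i assume "i \<in> {..<m}"
      then have "A i \<in> carrier_mat d d" "T i \<in> carrier_mat d d" using Ac T by auto
      then show "kron (A i) (T i) $$ (r, c) =
          A i $$ (r div d, c div d) * T i $$ (r mod d, c mod d)"
        using rc by (simp add: kron_def)
    qed
    finally show ?thesis .
  qed
  have "mrank M = d * d"
  proof (rule mrank_eq_dim_if_trivial_kernel[OF Mc])
    fix w assume w: "w \<in> carrier_vec (d * d)" "M *\<^sub>v w = 0\<^sub>v (d * d)"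
    define W where "W s t = w $ (s * d + t)" for s t
    have "(\<Sum>i<m. \<Sum>s<d. A i $$ (a, s) * (\<Sum>t<d. T i $$ (b, t) * W s t)) = 0"
      if ab: "a < d" "b < d" for a b
    proof -
      let ?r = "a * d + b"
      have r: "?r < d * d" using comb_less ab by simp
      have "0 = (M *\<^sub>v w) $ ?r" using w r by simp
      also have "\<dots> = (\<Sum>c<d * d. M $$ (?r, c) * w $ c)"
        using Mc w(1) r by (auto simp: scalar_prod_def atLeast0LessThan intro!: sum.cong)
      also have "\<dots> = (\<Sum>c<d * d. \<Sum>i<m. A i $$ (a, c div d) * (T i $$ (b, c mod d) * w $ c))"
        using M_entry[OF r] ab by (intro sum.cong) (simp_all add: sum_distrib_right mult.assoc)
      also have "\<dots> = (\<Sum>i<m. \<Sum>c<d * d. A i $$ (a, c div d) * (T i $$ (b, c mod d) * w $ c))"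
        by (rule sum.swap)
      also have "\<dots> = (\<Sum>i<m. \<Sum>(s, t)\<in>{..<d} \<times> {..<d}. A i $$ (a, s) * (T i $$ (b, t) * W s t))"
        by (intro sum.cong refl sum.reindex_bij_witness[where i = "\<lambda>(s, t). s * d + t"
              and j = "\<lambda>c. (c div d, c mod d)"]) (auto simp: W_def div_less comb_less)
      also have "\<dots> = (\<Sum>i<m. \<Sum>s<d. A i $$ (a, s) * (\<Sum>t<d. T i $$ (b, t) * W s t))"
        by (simp add: sum.cartesian_product sum_distrib_left)
      finally show ?thesis by simp
    qed
    then have W0: "W s t = 0" if "s < d" "t < d" for s t
      using ker that by blast
    show "w = 0\<^sub>v (d * d)"
    proof (rule eq_vecI)
      fix c assume "c < dim_vec (0\<^sub>v (d * d) :: 'a vec)"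
      then have c: "c < d * d" by simp
      then show "w $ c = 0\<^sub>v (d * d) $ c"
        using W0[OF div_less[OF c]] by (simp add: W_def)
    qed (use w in simp)
  qed
  note bounds = rk_attained_and_bound[OF blow_up_carrier[OF X, of d]]
  have "d * d \<le> rk (blow_up d d d X)"
    using bounds(2)[OF _ M_blow] M_blow \<open>mrank M = d * d\<close> by auto
  moreover have "rk (blow_up d d d X) \<le> d * d"
    using bounds(3) M_blow by auto
  ultimately show ?thesis by simp
qed

text \<open>
  With \<open>T\<^sub>i = L\<^sub>i\<^sup>T\<close> the map of the preceding lemma is \<open>W \<mapsto> \<Sum>\<^sub>i L\<^sub>i W L\<^sub>i\<close>, which in the coordinates of
  the exterior powers is the polarization map. The choice \<open>n = 2p + 1\<close> makes \<open>L\<^sub>i\<close> square.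
\<close>

lemma rk_blow_up_wedge_space:
  fixes p :: nat
  defines "n \<equiv> 2 * p + 1" and "d \<equiv> (2 * p + 1) choose p"
  shows "rk (blow_up d d d (wedge_space p n :: 'a::field_char_0 mat set)) = d * d"
proof -
  have dim: "n choose p = d" "n choose (p + 1) = d"
    using binomial_symmetric[of p n] by (simp_all add: n_def d_def)
  let ?L = "\<lambda>i. basis_wedge n p i :: 'a mat"
  have L: "?L i \<in> carrier_mat d d" for i
    using basis_wedge_carrier[of n p i, where 'a = 'a] by (simp only: dim)
  show ?thesis
  proof (rule blow_up_full_rank[where A = ?L and T = "\<lambda>i. transpose_mat (?L i)" and m = n])
    show "?L i \<in> wedge_space p n" if "i < n" for i
      by (simp add: wedge_space_def)
    show "wedge_space p n \<subseteq> carrier_mat d d"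
      using wedge_space_carrier[of p n] by (simp only: dim)
    show "transpose_mat (?L i) \<in> carrier_mat d d" for i
      using L by simp
    show "d > 0" by (simp add: d_def)
  next
    fix W :: "nat \<Rightarrow> nat \<Rightarrow> 'a" and s t
    assume W: "\<And>a b. a < d \<Longrightarrow> b < d \<Longrightarrow> (\<Sum>i<n. \<Sum>s<d. ?L i $$ (a, s) *
        (\<Sum>t<d. transpose_mat (?L i) $$ (b, t) * W s t)) = 0"
      and st: "s < d" "t < d"
    let ?p = "\<lambda>j. ext_basis n p ! j" and ?q = "\<lambda>j. ext_basis n (p + 1) ! j"
    have bp: "bij_betw ?p {..<d} {S. S \<subseteq> {0..<n} \<and> card S = p}"
      and bq: "bij_betw ?q {..<d} {S. S \<subseteq> {0..<n} \<and> card S = p + 1}"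
      using bij_ext_basis[of n p] bij_ext_basis[of n "p + 1"] by (simp_all only: dim)
    \<comment> \<open>Entries of \<open>W\<close> are relabelled by the index sets themselves instead of their positions.\<close>
    define u where "u S T = W (inv_into {..<d} ?p S) (inv_into {..<d} ?q T)" for S T
    have u: "u (?p a) (?q b) = W a b" if "a < d" "b < d" for a b
      using that bij_betw_inv_into_left[OF bp] bij_betw_inv_into_left[OF bq] by (simp add: u_def)
    have "u (?p s) (?q t) = 0"
    proof (rule polarization_injective[of "{0..<n}" p])
      fix S T assume S: "S \<subseteq> {0..<n}" "card S = Suc p" and T: "T \<subseteq> {0..<n}" "card T = p"
      have "S \<in> ?q ` {..<d}" "T \<in> ?p ` {..<d}"
        unfolding bij_betw_imp_surj_on[OF bp] bij_betw_imp_surj_on[OF bq] using S T by simp_all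
      then obtain a b where a: "a < d" "S = ?q a" and b: "b < d" "T = ?p b" by blast
      have transpose: "transpose_mat (?L i) $$ (b, t) = ?L i $$ (t, b)" if "t < d" for i t
        using L[of i] b that by auto
      have "0 = (\<Sum>i<n. \<Sum>s<d. ?L i $$ (a, s) * (\<Sum>t<d. transpose_mat (?L i) $$ (b, t) * W s t))"
        using W[OF a(1) b(1)] by simp
      also have "\<dots> = (\<Sum>i<n. \<Sum>s<d. ?L i $$ (a, s) * (\<Sum>t<d. ?L i $$ (t, b) * u (?p s) (?q t)))"
        by (intro sum.cong refl arg_cong2[of _ _ _ _ "(*)"]) (simp_all only: lessThan_iff transpose u)
      also have "\<dots> = (\<Sum>i<n. \<Sum>s<d. ?L i $$ (a, s) *
          (if i \<notin> T then shuffle_sign {i} T * u (?p s) (insert i T) else 0))"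
        using basis_wedge_column_sum[where n = n and p = p and c = b and 'a = 'a, unfolded dim] b
        by (intro sum.cong refl arg_cong2[of _ _ _ _ "(*)"]) simp
      also have "\<dots> = (\<Sum>i<n. if i \<in> S then shuffle_sign {i} (S - {i}) *
          (if i \<notin> T then shuffle_sign {i} T * u (S - {i}) (insert i T) else 0) else 0)"
      proof (intro sum.cong refl)
        fix i assume "i \<in> {..<n}"
        then have i: "i < n" by simp
        show "(\<Sum>s<d. ?L i $$ (a, s) *
            (if i \<notin> T then shuffle_sign {i} T * u (?p s) (insert i T) else 0)) =
          (if i \<in> S then shuffle_sign {i} (S - {i}) *
            (if i \<notin> T then shuffle_sign {i} T * u (S - {i}) (insert i T) else 0) else 0)"
          unfolding a(2)
          by (rule basis_wedge_row_sum[of i n a p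
                "\<lambda>A. if i \<notin> T then shuffle_sign {i} T * u A (insert i T) else 0", unfolded dim])
            (use i a in auto)
      qed
      also have "\<dots> = (\<Sum>i\<in>S - T. shuffle_sign {i} (S - {i}) * shuffle_sign {i} T
          * u (S - {i}) (insert i T))"
        using S by (intro sum.mono_neutral_cong_right) (auto simp: mult.assoc)
      finally show "(\<Sum>i\<in>S - T. shuffle_sign {i} (S - {i}) * shuffle_sign {i} T
          * u (S - {i}) (insert i T)) = 0" by simp
    qed (use st ext_basis_nth[of s n p] ext_basis_nth[of t n "p + 1"] dim in auto)
    then show "W s t = 0" using u st by simp
  qed
qed

section \<open>The ratio of the ranks\<close>

lemma ncrk_eq_of_full_blow_up:
  assumes X: "X \<subseteq> carrier_mat k l" and ne: "X \<noteq> {}"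
    and d: "d \<ge> 1" "rk (blow_up k l d X) = l * d"
  shows "ncrk k l X = real l"
  unfolding ncrk_def
proof (rule Greatest_equality)
  show "\<exists>d\<ge>1. real l = real (rk (blow_up k l d X)) / real d"
    using d by (intro exI[of _ d]) simp
next
  fix r assume "\<exists>d\<ge>1. r = real (rk (blow_up k l d X)) / real d"
  then obtain e where e: "e \<ge> 1" "r = real (rk (blow_up k l e X)) / real e" by blast
  have "0\<^sub>m (k * e) (l * e) \<in> blow_up k l e X"
    unfolding blow_up_def by (rule CollectI, rule exI[of _ "[]"]) simp
  then have "rk (blow_up k l e X) \<le> l * e"
    using rk_attained_and_bound(3)[OF blow_up_carrier[OF X]] by blast
  then have "real (rk (blow_up k l e X)) \<le> real l * real e"
    by (simp flip: of_nat_mult)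
  then show "r \<le> real l"
    using e by (simp add: divide_le_eq)
qed

theorem theorem1p15:
  fixes p :: nat and X :: "'a::field_char_0 mat set"
  assumes "X = wedge_space p (2 * p + 1)"
  shows "ncrk ((2 * p + 1) choose (p + 1)) ((2 * p + 1) choose p) X / real (rk X)
           = real (2 * p + 1) / real (p + 1)"
proof -
  define d where "d = (2 * p + 1) choose p"
  have sym: "(2 * p + 1) choose (p + 1) = d"
    using binomial_symmetric[of p "2 * p + 1"] by (simp add: d_def)
  have "rk (blow_up d d d X) = d * d"
    unfolding assms d_def by (rule rk_blow_up_wedge_space)
  moreover have "X \<subseteq> carrier_mat d d"
    using wedge_space_carrier[of p "2 * p + 1"] by (simp only: assms sym) (simp add: d_def)
  moreover have "d \<ge> 1" by (simp add: d_def Suc_le_eq)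
  ultimately have "ncrk d d X = real d"
    using wedge_space_nonempty by (intro ncrk_eq_of_full_blow_up) (auto simp: assms)
  moreover have "rk X = (2 * p) choose p"
    using rk_wedge_space[of "2 * p + 1" p] by (simp add: assms)
  moreover have "(p + 1) * d = (2 * p + 1) * ((2 * p) choose p)"
    using Suc_times_binomial[of p "2 * p"] sym by simp
  then have "real (p + 1) * real d = real (2 * p + 1) * real ((2 * p) choose p)"
    by (simp only: flip: of_nat_mult)
  moreover have "(2 * p) choose p > 0" by simp
  ultimately show ?thesis
    unfolding sym d_def[symmetric] by (simp add: field_simps del: of_nat_Suc of_nat_add)
qed

end
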